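(* Let $G$ be a minimal $(3,3)$-Ramsey graph with $\omega(G) = 3$. Then $\delta(G) \geq 8$. Moreover, if $v \in V(G)$ and $d(v) = 8$, then $G(v)$ is isomorphic to $N_{8.i}$ for some $i \in \{1,\dots,7\}$.
   Context: All graphs are finite, undirected, without loops or multiple edges. $\omega(G)$ is the clique number, $\delta(G)$ the minimum degree, $d(v)$ the degree of $v$, and $G(v)$ the subgraph of $G$ induced by the set of neighbors of $v$. A graph $G$ is a $(3,3)$-Ramsey graph, written $G \rightarrow (3,3)$, if every coloring of the edges of $G$ with two colors contains a monochromatic triangle. $G$ is a minimal $(3,3)$-Ramsey graph if $G \rightarrow (3,3)$ and no proper subgraph $H$ of $G$ satisfies $H \rightarrow (3,3)$. A 2-coloring of the edges of a graph is $(3,3)$-free if it has no monochromatic triangle. For a graph $N$, the set $V(N)$ is a marked vertex set in $N$ if there is a $(3,3)$-free 2-coloring of the edges of $N$ which cannot be extended to a $(3,3)$-free 2-coloring of the edges of the graph obtained from $N$ by adding a new vertex adjacent to all vertices of $N$. $N_{8.1},\dots,N_{8.7}$ denote the 8-vertex triangle-free graphs $N$ for which $V(N)$ is a marked vertex set in $N$; up to isomorphism there are exactly seven such graphs. *)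

theory Defs
  imports Main
begin

record 'a graph =
  verts :: "'a set"
  edges :: "'a set set"

definition simple_graph :: "'a graph \<Rightarrow> bool" where
  "simple_graph G \<longleftrightarrow>
     finite (verts G) \<and> (\<forall>e\<in>edges G. e \<subseteq> verts G \<and> card e = 2)"

definition neighbors :: "'a graph \<Rightarrow> 'a \<Rightarrow> 'a set" where
  "neighbors G v = {u \<in> verts G. {u, v} \<in> edges G}"

definition degree :: "'a graph \<Rightarrow> 'a \<Rightarrow> nat" where
  "degree G v = card (neighbors G v)"

text \<open>Only meaningful for finite graphs with at least one vertex.\<close>

definition min_degree :: "'a graph \<Rightarrow> nat" where
  "min_degree G = Min (degree G ` verts G)"

definition clique :: "'a graph \<Rightarrow> 'a set \<Rightarrow> bool" where
  "clique G S \<longleftrightarrow>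
     S \<subseteq> verts G \<and> (\<forall>u\<in>S. \<forall>v\<in>S. u \<noteq> v \<longrightarrow> {u, v} \<in> edges G)"

definition clique_number :: "'a graph \<Rightarrow> nat" where
  "clique_number G = Max (card ` {S. clique G S})"

definition induced_subgraph :: "'a graph \<Rightarrow> 'a set \<Rightarrow> 'a graph" where
  "induced_subgraph G S = \<lparr>verts = S, edges = {e \<in> edges G. e \<subseteq> S}\<rparr>"

text \<open>The graph written \<open>G(v)\<close> in the literature.\<close>

definition neighborhood_graph :: "'a graph \<Rightarrow> 'a \<Rightarrow> 'a graph" where
  "neighborhood_graph G v = induced_subgraph G (neighbors G v)"

definition subgraph :: "'a graph \<Rightarrow> 'a graph \<Rightarrow> bool" where
  "subgraph H G \<longleftrightarrow>
     simple_graph H \<and> verts H \<subseteq> verts G \<and> edges H \<subseteq> edges G"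

definition isomorphic :: "'a graph \<Rightarrow> 'b graph \<Rightarrow> bool" where
  "isomorphic G H \<longleftrightarrow>
     (\<exists>f. bij_betw f (verts G) (verts H) \<and>
          (\<forall>u\<in>verts G. \<forall>v\<in>verts G. {u, v} \<in> edges G \<longleftrightarrow> {f u, f v} \<in> edges H))"

text \<open>In a simple graph the three vertices are automatically distinct, since every edge has
  cardinality 2.\<close>

definition triangle :: "'a graph \<Rightarrow> 'a \<Rightarrow> 'a \<Rightarrow> 'a \<Rightarrow> bool" where
  "triangle G x y z \<longleftrightarrow> {x, y} \<in> edges G \<and> {y, z} \<in> edges G \<and> {x, z} \<in> edges G"

definition triangle_free :: "'a graph \<Rightarrow> bool" where
  "triangle_free G \<longleftrightarrow> (\<nexists>x y z. triangle G x y z)"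

text \<open>A 2-coloring of the edges is a function \<open>c\<close> from sets of vertices to \<^typ>\<open>bool\<close>, of which
  only the values on edges matter.\<close>

definition free33_coloring :: "'a graph \<Rightarrow> ('a set \<Rightarrow> bool) \<Rightarrow> bool" where
  "free33_coloring G c \<longleftrightarrow>
     (\<nexists>x y z. triangle G x y z \<and> c {x, y} = c {y, z} \<and> c {y, z} = c {x, z})"

definition ramsey33 :: "'a graph \<Rightarrow> bool" where
  "ramsey33 G \<longleftrightarrow> (\<forall>c. \<not> free33_coloring G c)"

definition minimal_ramsey33 :: "'a graph \<Rightarrow> bool" where
  "minimal_ramsey33 G \<longleftrightarrow>
     ramsey33 G \<and> (\<forall>H. subgraph H G \<and> H \<noteq> G \<longrightarrow> \<not> ramsey33 H)"

text \<open>Adds one new vertex, \<open>None\<close>, adjacent to all (old) vertices, which are renamed by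
  \<open>Some\<close>.\<close>

definition cone :: "'a graph \<Rightarrow> 'a option graph" where
  "cone N = \<lparr>verts = insert None (Some ` verts N),
             edges = (\<lambda>e. Some ` e) ` edges N \<union> (\<lambda>v. {None, Some v}) ` verts N\<rparr>"

text \<open>The whole vertex set of \<open>N\<close> is a marked vertex set in \<open>N\<close>.\<close>

definition all_marked :: "'a graph \<Rightarrow> bool" where
  "all_marked N \<longleftrightarrow>
     (\<exists>c. free33_coloring N c \<and>
          \<not> (\<exists>c'. free33_coloring (cone N) c' \<and> (\<forall>e\<in>edges N. c' (Some ` e) = c e)))"

definition marked8 :: "'a graph \<Rightarrow> bool" where
  "marked8 N \<longleftrightarrow> simple_graph N \<and> card (verts N) = 8 \<and> triangle_free N \<and> all_marked N"

text \<open>\<open>F 1, \<dots>, F 7\<close> is a repetition-free list, up to isomorphism, of all the graphs satisfying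
  \<^const>\<open>marked8\<close>. Every finite graph has an isomorphic copy with vertices in \<^typ>\<open>nat\<close>.\<close>

definition lists_marked8 :: "(nat \<Rightarrow> nat graph) \<Rightarrow> bool" where
  "lists_marked8 F \<longleftrightarrow>
     (\<forall>i\<in>{1..7}. marked8 (F i)) \<and>
     (\<forall>i\<in>{1..7}. \<forall>j\<in>{1..7}. i \<noteq> j \<longrightarrow> \<not> isomorphic (F i) (F j)) \<and>
     (\<forall>N :: nat graph. marked8 N \<longrightarrow> (\<exists>i\<in>{1..7}. isomorphic N (F i)))"

text \<open>\<open>N8 i\<close> is the graph $N_{8.i}$; the numbering is an arbitrary choice. That such a list of
  exactly seven graphs exists is a fact that has to be proved before anything can be
  concluded about \<open>N8\<close>.\<close>

definition N8 :: "nat \<Rightarrow> nat graph" where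
  "N8 = (SOME F. lists_marked8 F)"

end

theory Submission
  imports Defs
begin

text \<open>By minimality \<open>G - v\<close> has a \<open>(3,3)\<close>-free colouring, and as it does not extend to \<open>G\<close>, its
  restriction to \<open>G(v)\<close> does not extend to the cone over \<open>G(v)\<close>, a triangle-free graph.

  A colouring of a triangle-free graph extends to the cone iff its vertices can be coloured so that no
  edge has the colour of both its ends.  This is a 2-satisfiability problem, where giving \<open>u\<close> the colour
  \<open>s\<close> forces the colour \<open>\<not> s\<close> on the neighbours of \<open>u\<close> along \<open>s\<close>-edges, so implications are walks with
  alternating colours.  If it is unsolvable, shortest contradictory walks yield an odd cycle whose
  colours alternate except at a vertex \<open>z\<close>, where both edges have colour \<open>t\<close>, and an alternating
  ``lollipop'' (a path ending in an odd cycle) that leaves \<open>z\<close> by an edge of colour \<open>\<not> t\<close>.  In a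
  triangle-free graph on at most 8 vertices the first cycle has length 5 or 7, which leaves few enough
  possibilities for an exhaustive search: each of them uses 8 vertices and extends to triangle-free
  graphs of only seven isomorphism types.  These seven are told apart by the set of the sums of the
  degrees of the neighbours of a vertex.\<close>

section \<open>Colourings that do not extend to the cone\<close>

text \<open>\<open>R s u v\<close> says that \<open>u\<close> and \<open>v\<close> are joined by an edge of colour \<open>s\<close>.\<close>

locale coloured_graph =
  fixes V :: "'a set" and R :: "bool \<Rightarrow> 'a \<Rightarrow> 'a \<Rightarrow> bool"
  assumes finite_V: "finite V"
    and R_in: "R s u v \<Longrightarrow> u \<in> V"
    and R_sym: "R s u v \<Longrightarrow> R s v u"
    and R_unique: "R s u v \<Longrightarrow> R t u v \<Longrightarrow> s = t"
    and R_no_triangle: "R r u v \<Longrightarrow> R s v w \<Longrightarrow> R t u w \<Longrightarrow> False"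
begin

lemma R_irrefl: "\<not> R s u u"
  using R_no_triangle by blast

text \<open>Here \<open>x u\<close> is the colour proposed for the edge from the apex of the cone to
  \<open>u\<close>; an edge of colour \<open>s\<close> whose ends both get \<open>s\<close> forms a
  monochromatic triangle with the apex.\<close>

definition unextendable :: bool where
  "unextendable \<longleftrightarrow> (\<forall>x. \<exists>s u v. R s u v \<and> x u = s \<and> x v = s)"

text \<open>The pair \<open>(u, s)\<close> stands for the decision to give colour \<open>s\<close> to the edge from the apex of
  the cone to \<open>u\<close>.\<close>

definition imp :: "(('a \<times> bool) \<times> ('a \<times> bool)) set" where
  "imp = {((u, s), (v, \<not> s)) |u v s. R s u v}"

lemma imp_contrapos1: "((u, s), (v, t)) \<in> imp \<Longrightarrow> ((v, \<not> t), (u, \<not> s)) \<in> imp"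
  unfolding imp_def using R_sym by auto

lemma imp_contrapos: "((u, s), (v, t)) \<in> imp\<^sup>* \<Longrightarrow> ((v, \<not> t), (u, \<not> s)) \<in> imp\<^sup>*"
proof (induction "(v, t)" arbitrary: v t rule: rtrancl_induct)
  case (step y)
  then show ?case
    by (cases y) (blast intro: imp_contrapos1 converse_rtrancl_into_rtrancl)
qed simp

text \<open>The criterion for 2-satisfiability: a maximal consistent set \<open>A\<close> of
  decisions closed under \<open>imp\<close> would decide every vertex, and so be a solution, unless
  some vertex is forced from each colour to the other.\<close>

lemma unextendable_contradiction:
  assumes unextendable
  shows "\<exists>w. ((w, True), (w, False)) \<in> imp\<^sup>* \<and> ((w, False), (w, True)) \<in> imp\<^sup>*"
proof (rule ccontr)
  assume no: "\<not> ?thesis"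
  define good where "good A \<longleftrightarrow> A \<subseteq> V \<times> UNIV \<and> (\<forall>a b. a \<in> A \<longrightarrow> (a, b) \<in> imp \<longrightarrow> b \<in> A)
      \<and> (\<forall>v. \<not> ((v, True) \<in> A \<and> (v, False) \<in> A))" for A
  have "finite (Collect good)"
    by (rule finite_subset[of _ "Pow (V \<times> UNIV)"]) (auto simp: good_def finite_V)
  moreover have "{} \<in> Collect good" by (auto simp: good_def)
  ultimately obtain A where A: "good A" and max: "\<And>B. good B \<Longrightarrow> A \<subseteq> B \<Longrightarrow> A = B"
    using finite_has_maximal[of "Collect good"] by blast
  have closed: "b \<in> A" if "a \<in> A" "(a, b) \<in> imp\<^sup>*" for a b
    using that(2,1) by (induction rule: rtrancl_induct) (use A good_def in blast)+
  have total: "\<exists>s. (w, s) \<in> A" if "w \<in> V" for w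
  proof (rule ccontr)
    assume un: "\<nexists>s. (w, s) \<in> A"
    have "((w, s), (w, \<not> s)) \<in> imp\<^sup>*" for s
    proof -
      define C where "C = {b. ((w, s), b) \<in> imp\<^sup>*}"
      have "C \<subseteq> V \<times> UNIV"
      proof
        fix b assume "b \<in> C"
        then have "((w, s), b) \<in> imp\<^sup>*" by (simp add: C_def)
        then show "b \<in> V \<times> UNIV"
        proof (induction rule: rtrancl_induct)
          case (step y z)
          then show ?case using R_in R_sym unfolding imp_def by blast
        qed (use \<open>w \<in> V\<close> in simp)
      qed
      moreover have "(w, s) \<in> C" "(w, s) \<notin> A" using un by (auto simp: C_def)
      ultimately have "\<not> good (A \<union> C)" using max[of "A \<union> C"] by blast
      moreover have "A \<union> C \<subseteq> V \<times> UNIV" using A \<open>C \<subseteq> _\<close> by (auto simp: good_def)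
      moreover have "b \<in> A \<union> C" if "a \<in> A \<union> C" "(a, b) \<in> imp" for a b
        using that closed[of a b] rtrancl_into_rtrancl[of "(w, s)" a imp b]
        by (auto simp: C_def)
      ultimately obtain v where v: "(v, True) \<in> A \<union> C" "(v, False) \<in> A \<union> C"
        unfolding good_def by blast
      \<comment> \<open>The clash at \<open>v\<close> lies within \<open>C\<close> alone: if one of
        the two decisions were in \<open>A\<close>, the contrapositive of a chain from
        \<open>(w, s)\<close> would put \<open>(w, \<not> s)\<close> into \<open>A\<close>.\<close>
      have "(v, t) \<in> C" for t
      proof (rule ccontr)
        assume "(v, t) \<notin> C"
        then have "(v, t) \<in> A" using v by (cases t) auto
        moreover from this have "(v, \<not> t) \<in> C"
          using v A by (cases t) (auto simp: good_def)
        ultimately have "(w, \<not> s) \<in> A"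
          using closed[of "(v, t)"] imp_contrapos[of w s v "\<not> t"] by (auto simp: C_def)
        then show False using un by blast
      qed
      then have "((w, s), (v, True)) \<in> imp\<^sup>*" "((w, s), (v, False)) \<in> imp\<^sup>*"
        by (auto simp: C_def)
      then show ?thesis using imp_contrapos[of w s v False] by auto
    qed
    from this[of True] this[of False] show False using no by auto
  qed
  define x where "x u \<longleftrightarrow> (u, True) \<in> A" for u
  have x: "(u, x u) \<in> A" if u: "u \<in> V" for u
  proof -
    obtain s where "(u, s) \<in> A" using total[OF u] by blast
    then show ?thesis by (cases s; cases "x u") (auto simp: x_def)
  qed
  obtain s u v where uv: "R s u v" "x u = s" "x v = s" using assms unextendable_def by blast
  then have in_A: "(u, s) \<in> A" "(v, s) \<in> A"
    using x[OF R_in[OF uv(1)]] x[OF R_in[OF R_sym[OF uv(1)]]] by simp_all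
  have "((u, s), (v, \<not> s)) \<in> imp" using uv by (auto simp: imp_def)
  then have "(v, \<not> s) \<in> A" using closed[OF in_A(1) r_into_rtrancl] by blast
  then show False using in_A(2) A unfolding good_def by (cases s) auto
qed

end

section \<open>Alternating walks, odd cycles and lollipops\<close>

fun awalk :: "(bool \<Rightarrow> 'a \<Rightarrow> 'a \<Rightarrow> bool) \<Rightarrow> bool \<Rightarrow> 'a list \<Rightarrow> bool" where
  "awalk R s [] = False"
| "awalk R s [u] = True"
| "awalk R s (u # v # us) = (R s u v \<and> awalk R (\<not> s) (v # us))"

lemma awalk_append:
  "awalk R s (us @ u # ws) \<longleftrightarrow>
    awalk R s (us @ [u]) \<and> awalk R (if even (length us) then s else \<not> s) (u # ws)"
proof (induction us arbitrary: s)
  case (Cons v us)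
  then show ?case by (cases us) auto
qed simp

lemma awalk_nth:
  "awalk R s ws \<Longrightarrow> Suc i < length ws \<Longrightarrow>
    R (if even i then s else \<not> s) (ws ! i) (ws ! Suc i)"
proof (induction R s ws arbitrary: i rule: awalk.induct)
  case (3 R s u v us)
  show ?case
  proof (cases i)
    case (Suc j)
    with 3 have "R (if even j then \<not> s else \<not> \<not> s) ((v # us) ! j) ((v # us) ! Suc j)"
      by (intro "3.IH") auto
    with Suc show ?thesis by (auto split: if_splits)
  qed (use 3 in auto)
qed auto

lemma awalk_flip: "awalk R s ws \<Longrightarrow> awalk (\<lambda>t. R (\<not> t)) (\<not> s) ws"
  by (induction R s ws rule: awalk.induct) auto

text \<open>The list is the walk made so far, its last vertex first.  It is continued, alternating the
  colours, until it meets itself for the first time, and it must then have closed an odd cycle.\<close>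

inductive lollipop :: "(bool \<Rightarrow> 'a \<Rightarrow> 'a \<Rightarrow> bool) \<Rightarrow> bool \<Rightarrow> 'a list \<Rightarrow> bool" for R where
  close: "R s u w \<Longrightarrow> w \<in> set (u # us) \<Longrightarrow>
    even (length (takeWhile (\<lambda>x. x \<noteq> w) (u # us))) \<Longrightarrow> lollipop R s (u # us)"
| step: "R s u w \<Longrightarrow> w \<notin> set (u # us) \<Longrightarrow> lollipop R (\<not> s) (w # u # us) \<Longrightarrow>
    lollipop R s (u # us)"

lemma lollipop_flip: "lollipop R s us \<Longrightarrow> lollipop (\<lambda>t. R (\<not> t)) (\<not> s) us"
  by (induction rule: lollipop.induct) (auto intro: lollipop.intros simp del: set_simps)

text \<open>Induction over the remaining walk \<open>zs\<close>, moving its vertices one by one to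
  the reversed past \<open>us\<close>. The list \<open>q\<close> holds the vertices between the two
  visits of \<open>y\<close>, so its even length makes the closed cycle odd.\<close>

lemma awalk_lollipop:
  assumes "awalk R s (u # zs @ [y])" "rev us @ u # zs = p @ y # q" "even (length q)"
    "distinct (p @ y # q)"
  shows "lollipop R s (u # us)"
  using assms
proof (induction zs arbitrary: s u us)
  case Nil
  then have "rev (u # us) = p @ y # q" by simp
  then have "rev (rev (u # us)) = rev q @ y # rev p" by (simp only: rev_append rev.simps) simp
  then have "u # us = rev q @ y # rev p" by (simp only: rev_rev_ident)
  moreover have "R s u y" using Nil by simp
  moreover have "takeWhile (\<lambda>x. x \<noteq> y) (rev q @ y # rev p) = rev q"
    using Nil.prems(4) by (subst takeWhile_append2) auto
  ultimately show ?case using Nil.prems(3) by (intro lollipop.close[where w = y]) simp_all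
next
  case (Cons w zs)
  have "distinct (rev us @ u # w # zs)" using Cons.prems by simp
  then have "w \<notin> set (u # us)" by auto
  moreover have "lollipop R (\<not> s) (w # u # us)"
  proof (rule Cons.IH)
    show "awalk R (\<not> s) (w # zs @ [y])" using Cons.prems(1) by simp
    show "rev (u # us) @ w # zs = p @ y # q" using Cons.prems(2) by simp
  qed (use Cons.prems in simp_all)
  moreover have "R s u w" using Cons.prems(1) by simp
  ultimately show ?case by (blast intro: lollipop.step)
qed

context coloured_graph
begin

lemma imp_imp_awalk:
  "((u, s), (v, t)) \<in> imp\<^sup>* \<Longrightarrow>
    \<exists>ws. awalk R s (u # ws) \<and> last (u # ws) = v \<and> (s = t \<longleftrightarrow> even (length ws))"
proof (induction "(u, s)" arbitrary: u s rule: converse_rtrancl_induct)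
  case base
  show ?case by (rule exI[of _ "[]"]) simp
next
  case (step z)
  from step.hyps(1) obtain w where w: "z = (w, \<not> s)" "R s u w" by (auto simp: imp_def)
  with step.hyps(3) obtain ws where
    "awalk R (\<not> s) (w # ws)" "last (w # ws) = v" "\<not> s = t \<longleftrightarrow> even (length ws)" by blast
  with w show ?case by (intro exI[of _ "w # ws"]) auto
qed

lemma awalk_imp:
  "awalk R s (u # ws) \<Longrightarrow>
    ((u, s), (last (u # ws), if even (length ws) then s else \<not> s)) \<in> imp\<^sup>*"
proof (induction ws arbitrary: u s)
  case (Cons w ws)
  then have "((u, s), (w, \<not> s)) \<in> imp" by (auto simp: imp_def)
  also have "((w, \<not> s), (last (w # ws), if even (length ws) then \<not> s else \<not> \<not> s)) \<in> imp\<^sup>*"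
    using Cons by (intro Cons.IH) auto
  finally show ?case by auto
qed simp

text \<open>A shortest contradictory walk, one with an odd number of edges from \<open>u\<close>
  back to \<open>u\<close>, is cut at its first repeated vertex \<open>y\<close>. If the loop at
  \<open>y\<close> had an even number of edges, leaving it out would preserve the alternation and
  give a shorter contradictory walk.\<close>

lemma first_return:
  assumes "((u, s), (u, \<not> s)) \<in> imp\<^sup>*"
  obtains p y q where "awalk R s (p @ y # q @ [y])" "hd (p @ [y]) = u" "distinct (p @ y # q)"
    "even (length q)"
proof -
  define P where "P ws \<longleftrightarrow> awalk R s ws \<and> hd ws = u \<and> last ws = u \<and> even (length ws)" for ws
  have "\<exists>ws. P ws"
  proof -
    obtain ws where "awalk R s (u # ws)" "last (u # ws) = u" "odd (length ws)"
      using imp_imp_awalk[OF assms] by auto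
    then show ?thesis unfolding P_def by (intro exI[of _ "u # ws"]) auto
  qed
  then obtain ws where ws: "P ws" and least: "\<And>us. P us \<Longrightarrow> length ws \<le> length us"
    using ex_has_least_nat[of P _ length] by blast
  have nd: "\<not> distinct ws"
  proof
    assume d: "distinct ws"
    obtain w ws' where "ws = w # ws'" using ws by (cases ws) (auto simp: P_def)
    with d ws show False
      by (cases ws' rule: rev_cases) (auto simp: P_def)
  qed
  from iffD1[OF not_distinct_conv_prefix nd]
  obtain xs y ys where d: "y \<in> set xs" "distinct xs" "ws = xs @ y # ys" by blast
  then obtain p q where xs: "xs = p @ y # q"
    using split_list[OF d(1)] by blast
  have walk: "awalk R s (p @ y # q @ y # ys)" using ws d xs by (simp add: P_def)
  have "even (length q)"
  proof (rule ccontr)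
    assume odd: "odd (length q)"
    have "awalk R s (p @ [y])" using walk awalk_append[of R s p y] by blast
    moreover have "awalk R (if even (length p) then s else \<not> s) (y # ys)"
      using walk odd awalk_append[of R s p y "q @ y # ys"]
        awalk_append[of R _ "y # q" y ys] by (auto split: if_splits)
    ultimately have "awalk R s (p @ y # ys)" using awalk_append[of R s p y] by blast
    moreover have "hd (p @ y # ys) = u" using ws d xs by (cases p) (auto simp: P_def)
    ultimately have "P (p @ y # ys)" using ws d xs odd by (auto simp: P_def)
    from least[OF this] d xs show False by simp
  qed
  moreover have "awalk R s (p @ y # q @ [y])"
    using walk awalk_append[of R s "p @ y # q" y ys] by simp
  moreover have "hd (p @ [y]) = u" using ws d xs by (cases p) (auto simp: P_def)
  ultimately show ?thesis using that d xs by blast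
qed

text \<open>The first return of a walk from \<open>(w, True)\<close> to \<open>(w, False)\<close>
  closes an odd cycle at \<open>z\<close>; an odd alternating closed walk begins and ends with the
  same colour \<open>t\<close>. A second first return, started at \<open>(z, \<not> t)\<close>,
  gives the lollipop.\<close>

lemma unextendable_cycle_lollipop:
  assumes unextendable
  obtains t z q where "awalk R t (z # q @ [z])" "distinct (z # q)" "even (length q)"
    "lollipop R (\<not> t) [z]"
proof -
  obtain w where w: "((w, True), (w, False)) \<in> imp\<^sup>*" "((w, False), (w, True)) \<in> imp\<^sup>*"
    using unextendable_contradiction[OF assms] by blast
  have "((w, True), (w, \<not> True)) \<in> imp\<^sup>*" using w by simp
  from first_return[OF this] obtain p z q where
    pzq: "awalk R True (p @ z # q @ [z])" "hd (p @ [z]) = w" "distinct (p @ z # q)"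
      "even (length q)" .
  define t where "t \<longleftrightarrow> even (length p)"
  have walk: "awalk R t (z # q @ [z])" "awalk R True (p @ [z])"
    using pzq(1) awalk_append[of R True p z "q @ [z]"] by (auto simp: t_def split: if_splits)
  obtain p' where "p @ [z] = w # p'" using pzq(2) by (cases p) auto
  then have "((w, True), (z, t)) \<in> imp\<^sup>*"
    using walk(2) awalk_imp[of True w p'] last_snoc[of p z] t_def
    by (cases p) (auto split: if_splits)
  \<comment> \<open>The chain runs from \<open>(z, \<not> t)\<close> by contraposition to
    \<open>(w, False)\<close>, on to \<open>(w, True)\<close> and from there to
    \<open>(z, t)\<close>.\<close>
  from this imp_contrapos[OF this] w have "((z, \<not> t), (z, \<not> \<not> t)) \<in> imp\<^sup>*"
    by (cases t) (auto intro: rtrancl_trans)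
  from first_return[OF this] obtain p2 y q2 where
    y: "awalk R (\<not> t) (p2 @ y # q2 @ [y])" "hd (p2 @ [y]) = z" "distinct (p2 @ y # q2)"
      "even (length q2)" .
  then obtain zs where zs: "p2 @ y # q2 = z # zs" by (cases p2) auto
  have "lollipop R (\<not> t) [z]"
  proof (rule awalk_lollipop)
    have "(p2 @ y # q2) @ [y] = (z # zs) @ [y]" using zs by (rule arg_cong)
    then show "awalk R (\<not> t) (z # zs @ [y])" using y(1) by (simp only: append_Cons append_assoc)
    show "rev [] @ z # zs = p2 @ y # q2" using zs by simp
  qed (use y in auto)
  with walk pzq that show ?thesis by auto
qed

end

section \<open>Coloured graphs on eight labels\<close>

text \<open>A table is an 8 by 8 symmetric matrix whose entry at \<open>i\<close>, \<open>j\<close> is the colour of the edge between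
  the labels \<open>i\<close> and \<open>j\<close>, or \<^const>\<open>None\<close> if there is no edge (or it is not known yet).\<close>

type_synonym row = "bool option list"
type_synonym table = "row list"

definition wf_table :: "table \<Rightarrow> bool" where
  "wf_table m \<longleftrightarrow> length m = 8 \<and> (\<forall>i<8. length (m ! i) = 8) \<and> (\<forall>i<8. \<forall>j<8. m ! i ! j = m ! j ! i)"

text \<open>For the rows of two labels this says that they have a common neighbour, so that an edge
  between them would close a triangle.\<close>

fun common :: "row \<Rightarrow> row \<Rightarrow> bool" where
  "common (Some a # xs) (Some b # ys) = True"
| "common (Some a # xs) (None # ys) = common xs ys"
| "common (None # xs) (y # ys) = common xs ys"
| "common [] ys = False"
| "common xs [] = False"

definition put :: "table \<Rightarrow> nat \<Rightarrow> nat \<Rightarrow> bool \<Rightarrow> table" where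
  "put m i j s = m[i := (m ! i)[j := Some s]]"

definition join :: "table \<Rightarrow> nat \<Rightarrow> nat \<Rightarrow> bool \<Rightarrow> table" where
  "join m i j s = put (put m i j s) j i s"

text \<open>The result \<open>None\<close> means that the edge is impossible: it has the other
  colour already, or it would close a triangle.\<close>

definition place :: "table \<Rightarrow> nat \<Rightarrow> nat \<Rightarrow> bool \<Rightarrow> table option" where
  "place m i j s = (case m ! i ! j of
     Some t \<Rightarrow> if t = s then Some m else None
   | None \<Rightarrow> if common (m ! i) (m ! j) then None else Some (join m i j s))"

definition table_of :: "(nat \<times> nat \<times> bool) list \<Rightarrow> table" where
  "table_of es = fold (\<lambda>(i, j, s) m. join m i j s) es (replicate 8 (replicate 8 None))"

lemma ex_nat_Suc_split: "(\<exists>k. P k) \<longleftrightarrow> P 0 \<or> (\<exists>k. P (Suc k))"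
  by (metis not0_implies_Suc)

lemma common_iff:
  "common xs ys \<longleftrightarrow>
    (\<exists>k. k < length xs \<and> k < length ys \<and> xs ! k \<noteq> None \<and> ys ! k \<noteq> None)" (is "_ \<longleftrightarrow> ?P xs ys")
proof -
  have P: "?P (x # xs) (y # ys) \<longleftrightarrow> x \<noteq> None \<and> y \<noteq> None \<or> ?P xs ys" for x y xs ys
    by (subst ex_nat_Suc_split) simp
  show ?thesis
    by (induction xs ys rule: common.induct) (simp_all only: P common.simps, simp_all)
qed

lemma put_nth:
  "i < length m \<Longrightarrow> j < length (m ! i) \<Longrightarrow>
    put m i j s ! a ! b = (if a = i \<and> b = j then Some s else m ! a ! b)"
  unfolding put_def by (cases "a = i") (simp_all add: nth_list_update)

lemma length_put [simp]: "length (put m i j s) = length m" "length (put m i j s ! a) = length (m ! a)"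
  by (simp_all add: put_def) (cases "i < length m"; cases "a = i"; simp add: not_less list_update_beyond)

lemma wf_tableD:
  assumes "wf_table m"
  shows "length m = 8" "i < 8 \<Longrightarrow> length (m ! i) = 8" "i < 8 \<Longrightarrow> j < 8 \<Longrightarrow> m ! i ! j = m ! j ! i"
proof -
  have m: "length m = 8 \<and> (\<forall>i<8. length (m ! i) = 8) \<and> (\<forall>i<8. \<forall>j<8. m ! i ! j = m ! j ! i)"
    using assms unfolding wf_table_def .
  from m show "length m = 8" by (rule conjunct1)
  from m show "length (m ! i) = 8" if "i < 8" using that by blast
  from m show "m ! i ! j = m ! j ! i" if "i < 8" "j < 8" using that by blast
qed

lemma join_nth:
  assumes "wf_table m" "i < 8" "j < 8"
  shows "join m i j s ! a ! b =
    (if a = j \<and> b = i then Some s else if a = i \<and> b = j then Some s else m ! a ! b)"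
proof -
  have i: "i < length m" "j < length (m ! i)" and j: "j < length m" "i < length (m ! j)"
    using assms by (simp_all add: wf_tableD(1,2))
  have "join m i j s ! a ! b =
      (if a = j \<and> b = i then Some s else put m i j s ! a ! b)"
    unfolding join_def using j by (intro put_nth) simp_all
  then show ?thesis unfolding put_nth[OF i] .
qed

lemma wf_table_join:
  assumes "wf_table m" "i < 8" "j < 8"
  shows "wf_table (join m i j s)"
proof -
  have "join m i j s ! a ! b = join m i j s ! b ! a" if "a < 8" "b < 8" for a b
    using wf_tableD(3)[OF assms(1) that] unfolding join_nth[OF assms] by argo
  then show ?thesis
    using wf_tableD(1,2)[OF assms(1)] unfolding wf_table_def by (simp add: join_def)
qed

text \<open>The vertex with label \<open>i\<close> is \<open>vs ! i\<close>. Only entries present in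
  the table make a claim, so a table may be partial. The relation \<open>Q\<close> is a parameter
  because colours are kept along lollipops but forgotten when further edges are added.\<close>

definition fits :: "(bool \<Rightarrow> 'a \<Rightarrow> 'a \<Rightarrow> bool) \<Rightarrow> table \<Rightarrow> 'a list \<Rightarrow> bool" where
  "fits Q m vs \<longleftrightarrow> wf_table m \<and> (\<forall>i<8. \<forall>j<8. \<forall>s. m ! i ! j = Some s \<longrightarrow>
     i < length vs \<and> j < length vs \<and> Q s (vs ! i) (vs ! j))"

lemma fits_mono: "fits Q m vs \<Longrightarrow> (\<And>s u v. Q s u v \<Longrightarrow> Q' s u v) \<Longrightarrow> fits Q' m vs"
  unfolding fits_def by blast

lemma fits_snoc: "fits Q m vs \<Longrightarrow> fits Q m (vs @ [w])"
  unfolding fits_def by (simp add: nth_append less_SucI)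

lemma fits_join:
  assumes "fits Q m vs" "i < 8" "j < 8" "i < length vs" "j < length vs"
    "Q s (vs ! i) (vs ! j)" "Q s (vs ! j) (vs ! i)"
  shows "fits Q (join m i j s) vs"
proof -
  have m: "wf_table m" using assms(1) by (simp add: fits_def)
  show ?thesis
    using assms unfolding fits_def join_nth[OF m assms(2,3)]
    by (simp add: wf_table_join[OF m assms(2,3)])
qed

lemma fits_table_of:
  assumes "length vs \<le> 8"
    "\<And>i j s. (i, j, s) \<in> set es \<Longrightarrow>
      i < length vs \<and> j < length vs \<and> Q s (vs ! i) (vs ! j) \<and> Q s (vs ! j) (vs ! i)"
  shows "fits Q (table_of es) vs"
proof -
  have *: "fits Q (fold (\<lambda>(i, j, s) m. join m i j s) es m) vs" if "fits Q m vs" for m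
    using that assms(2)
  proof (induction es arbitrary: m)
    case (Cons e es)
    obtain i j s where e: "e = (i, j, s)" by (cases e)
    have "fits Q (join m i j s) vs"
      using Cons.prems(1) Cons.prems(2)[of i j s] assms(1) e by (intro fits_join) auto
    from Cons.IH[OF this Cons.prems(2)] show ?case using e by simp
  qed simp
  show ?thesis
    unfolding table_of_def by (rule *) (simp add: fits_def wf_table_def)
qed

lemma (in coloured_graph) fits_not_common:
  assumes "fits Q m vs" "\<And>s u v. Q s u v \<Longrightarrow> \<exists>t. R t u v" "i < 8" "j < 8" "R s (vs ! i) (vs ! j)"
  shows "\<not> common (m ! i) (m ! j)"
proof
  have m: "length (m ! i) = 8" "length (m ! j) = 8"
    using assms(1,3,4) by (auto simp: fits_def wf_table_def)
  assume "common (m ! i) (m ! j)"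
  then obtain k a b where k: "k < 8" "m ! i ! k = Some a" "m ! j ! k = Some b"
    using m by (auto simp: common_iff)
  then have "Q a (vs ! i) (vs ! k)" "Q b (vs ! j) (vs ! k)"
    using assms by (auto simp: fits_def)
  then show False using assms(2,5) R_no_triangle by blast
qed

lemma (in coloured_graph) place_fits:
  assumes "fits R m vs" "i < 8" "j < 8" "i < length vs" "j < length vs" "R s (vs ! i) (vs ! j)"
  obtains m' where "place m i j s = Some m'" "fits R m' vs"
proof (cases "m ! i ! j")
  case None
  have "\<not> common (m ! i) (m ! j)" using assms by (intro fits_not_common[of R]) auto
  with None show ?thesis
    using that fits_join[OF assms(1-6)] R_sym assms(6) by (auto simp: place_def)
next
  case (Some t)
  then have "R t (vs ! i) (vs ! j)" using assms(1-3) by (simp add: fits_def)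
  then have "t = s" using R_unique assms(6) by blast
  with Some show ?thesis using that assms(1) by (auto simp: place_def)
qed

section \<open>Recognising a table up to isomorphism\<close>

fun row_degree :: "row \<Rightarrow> nat" where
  "row_degree [] = 0"
| "row_degree (None # xs) = row_degree xs"
| "row_degree (Some a # xs) = Suc (row_degree xs)"

text \<open>Presence of edges is compared, not their colours: the isomorphism sought is one of the
  underlying graphs.\<close>

fun agree :: "row \<Rightarrow> row \<Rightarrow> nat \<Rightarrow> nat list \<Rightarrow> bool" where
  "agree xs ys y [] = True"
| "agree [] ys y (z # zs) = False"
| "agree (None # xs) ys y (z # zs) =
    (if y = z then False else if ys ! z = None then agree xs ys y zs else False)"
| "agree (Some a # xs) ys y (z # zs) =
    (if y = z then False else if ys ! z = None then False else agree xs ys y zs)"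

text \<open>Backtracking search for an isomorphism: \<open>p\<close> lists the images of the first labels, the rows of the
  other labels are the first argument, and the last one holds the candidates for the next image.\<close>

fun embeds :: "table \<Rightarrow> table \<Rightarrow> nat list \<Rightarrow> nat list \<Rightarrow> bool" where
  "embeds [] h p ys = True"
| "embeds (r # rs) h p [] = False"
| "embeds (r # rs) h p (y # ys) =
    (if row_degree r = row_degree (h ! y) then
       if agree r (h ! y) y p then
         if embeds rs h (p @ [y]) [0..<8] then True else embeds (r # rs) h p ys
       else embeds (r # rs) h p ys
     else embeds (r # rs) h p ys)"

fun count_degree :: "nat \<Rightarrow> table \<Rightarrow> nat" where
  "count_degree d [] = 0"
| "count_degree d (r # rs) =
    (if row_degree r = d then Suc (count_degree d rs) else count_degree d rs)"

text \<open>Comparing numbers of vertices of given degrees only serves to discard most of the list cheaply.\<close>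

fun recognised :: "table \<Rightarrow> table list \<Rightarrow> bool" where
  "recognised m [] = False"
| "recognised m (h # hs) =
    (if count_degree 2 m = count_degree 2 h then
       if count_degree 4 m = count_degree 4 h then
         if embeds m h [] [0..<8] then True else recognised m hs
       else recognised m hs
     else recognised m hs)"

lemma agree_sound:
  "agree xs ys y zs \<Longrightarrow> y \<notin> set zs \<and> length zs \<le> length xs \<and>
    (\<forall>b < length zs. xs ! b = None \<longleftrightarrow> ys ! (zs ! b) = None)"
proof (induction xs ys y zs rule: agree.induct)
  case (3 xs ys y z zs)
  then show ?case by (auto simp: nth_Cons split: if_splits nat.splits)
next
  case (4 a xs ys y z zs)
  then show ?case by (auto simp: nth_Cons split: if_splits nat.splits)
qed auto

text \<open>The first row of \<open>rs\<close> belongs to the label \<open>length p\<close>. Each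
  row is compared only with labels that already have an image, which gives the entries below the
  diagonal.\<close>

lemma embeds_sound:
  assumes "embeds rs h p ys" "set ys \<subseteq> {..<8}" "distinct p" "set p \<subseteq> {..<8}"
  shows "\<exists>q. length q = length rs \<and> distinct (p @ q) \<and> set (p @ q) \<subseteq> {..<8} \<and>
    (\<forall>a < length rs. \<forall>b < length p + a.
      rs ! a ! b = None \<longleftrightarrow> h ! (q ! a) ! ((p @ q) ! b) = None)"
  using assms
proof (induction rs h p ys rule: embeds.induct)
  case (3 r rs h p y ys)
  show ?case
  proof (cases "row_degree r = row_degree (h ! y) \<and> agree r (h ! y) y p \<and>
      embeds rs h (p @ [y]) [0..<8]")
    case True
    then have y: "y \<notin> set p" "\<forall>b < length p. r ! b = None \<longleftrightarrow> h ! y ! (p ! b) = None"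
      using agree_sound by blast+
    obtain q where q: "length q = length rs" "distinct ((p @ [y]) @ q)"
      "set ((p @ [y]) @ q) \<subseteq> {..<8}"
      "\<forall>a < length rs. \<forall>b < length (p @ [y]) + a.
        rs ! a ! b = None \<longleftrightarrow> h ! (q ! a) ! (((p @ [y]) @ q) ! b) = None"
      using "3.IH"(1) True "3.prems" y by (auto simp: atLeast0LessThan)
    have "(r # rs) ! a ! b = None \<longleftrightarrow> h ! ((y # q) ! a) ! ((p @ y # q) ! b) = None"
      if "a < length (r # rs)" "b < length p + a" for a b
    proof (cases a)
      case 0
      then show ?thesis using y that by (simp add: nth_append)
    next
      case (Suc c)
      then show ?thesis using q(4) that by simp
    qed
    then show ?thesis using q by (intro exI[of _ "y # q"]) auto
  next
    case False
    then have "embeds (r # rs) h p ys" using "3.prems"(1) by (auto split: if_splits)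
    moreover have "set ys \<subseteq> {..<8}" using "3.prems"(2) by simp
    ultimately show ?thesis using "3.IH"(2-4) "3.prems"(3,4) False by blast
  qed
qed simp_all

lemma recognised_sound:
  "recognised m hs \<Longrightarrow> \<exists>h \<in> set hs. embeds m h [] [0..<8]"
  by (induction m hs rule: recognised.induct) (auto split: if_splits)

text \<open>Symmetry and the empty diagonals supply the entries that the search does not
  compare.\<close>

lemma embeds_iso:
  assumes "embeds m h [] [0..<8]" "wf_table m" "wf_table h"
    and "\<And>i. i < 8 \<Longrightarrow> m ! i ! i = None" "\<And>i. i < 8 \<Longrightarrow> h ! i ! i = None"
  obtains q where "length q = 8" "distinct q" "set q \<subseteq> {..<8}"
    "\<And>i j. i < 8 \<Longrightarrow> j < 8 \<Longrightarrow> m ! i ! j = None \<longleftrightarrow> h ! (q ! i) ! (q ! j) = None"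
proof -
  obtain q where q: "length q = length m" "distinct q" "set q \<subseteq> {..<8}"
    and lower: "\<forall>a < length m. \<forall>b < a. m ! a ! b = None \<longleftrightarrow> h ! (q ! a) ! (q ! b) = None"
    using embeds_sound[OF assms(1)] by (auto simp: atLeast0LessThan)
  have m: "length m = 8" using assms(2) by (rule wf_tableD)
  have q8: "q ! i < 8" if "i < 8" for i using q(1,3) m that nth_mem by force
  have "m ! i ! j = None \<longleftrightarrow> h ! (q ! i) ! (q ! j) = None" if "i < 8" "j < 8" for i j
  proof (cases i j rule: linorder_cases)
    case less
    then show ?thesis
      using lower m that wf_tableD(3)[OF assms(2) that]
        wf_tableD(3)[OF assms(3) q8[OF that(1)] q8[OF that(2)]] by simp
  next
    case equal
    then show ?thesis using assms(4,5) q8 that by simp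
  next
    case greater
    then show ?thesis using lower m that by simp
  qed
  with q m that show ?thesis by simp
qed

section \<open>The seven graphs and the exhaustive search\<close>

text \<open>The edges of the first and those of the second colour, in a colouring that does not extend to the
  cone.\<close>

definition marked_edges :: "((nat \<times> nat) list \<times> (nat \<times> nat) list) list" where
  "marked_edges = [
  ([(0, 1), (0, 4), (2, 3), (2, 7), (3, 5), (5, 6)], [(0, 5), (0, 7), (1, 2), (2, 6), (3, 4)]),
  ([(0, 1), (0, 6), (1, 2), (2, 6), (3, 4), (3, 7), (4, 5), (5, 7)],
   [(0, 7), (1, 4), (2, 3), (5, 6)]),
  ([(0, 1), (0, 4), (1, 2), (2, 5), (3, 6), (5, 7)], [(0, 5), (1, 6), (2, 3), (3, 4), (6, 7)]),
  ([(0, 1), (0, 4), (2, 3), (4, 7), (5, 6)], [(0, 5), (1, 2), (2, 6), (3, 4), (6, 7)]),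
  ([(0, 1), (0, 4), (1, 2), (2, 3), (4, 6), (5, 7)],
   [(0, 5), (1, 7), (2, 5), (2, 6), (3, 4), (4, 7)]),
  ([(0, 1), (0, 4), (1, 6), (2, 3), (2, 5), (5, 7)], [(0, 5), (1, 2), (3, 4), (6, 7)]),
  ([(0, 1), (0, 4), (2, 3), (3, 5), (6, 7)], [(0, 5), (0, 7), (1, 2), (3, 4), (3, 6)])]"

definition coloured_edges :: "(nat \<times> nat) list \<times> (nat \<times> nat) list \<Rightarrow> (nat \<times> nat \<times> bool) list" where
  "coloured_edges e =
    map (\<lambda>(i, j). (i, j, True)) (fst e) @ map (\<lambda>(i, j). (i, j, False)) (snd e)"

definition catalogue :: "table list" where
  "catalogue = map (\<lambda>e. table_of (coloured_edges e)) marked_edges"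

text \<open>Branches over all ways of adding edges at the listed pairs without closing a triangle,
  and demands that every outcome be recognised. The colour \<open>True\<close> of an added edge is a
  placeholder, as only the underlying graph matters from here on.\<close>

fun complete :: "(nat \<times> nat) list \<Rightarrow> table \<Rightarrow> bool" where
  "complete [] m = recognised m catalogue"
| "complete ((i, j) # ps) m =
    (if m ! i ! j = None then
       if common (m ! i) (m ! j) then complete ps m
       else complete ps m \<and> complete ps (join m i j True)
     else complete ps m)"

definition pairs :: "(nat \<times> nat) list" where
  "pairs = concat (map (\<lambda>j. map (\<lambda>i. (i, j)) [0..<j]) [0..<8])"

lemma set_pairs: "set pairs = {(i, j). i < j \<and> j < 8}"
  unfolding pairs_def by (auto simp: image_iff)

text \<open>Follows a lollipop: \<open>k\<close> labels are in use, \<open>path\<close> is the walk so far, last label first, the next edge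
  has colour \<open>s\<close> and leads to one of the labels in the last argument, and \<open>n\<close> bounds the number of
  further steps.\<close>

fun search :: "nat \<Rightarrow> nat \<Rightarrow> table \<Rightarrow> nat list \<Rightarrow> bool \<Rightarrow> nat list \<Rightarrow> bool" where
  "search n k m path s [] = True"
| "search 0 k m path s (y # ys) = False"
| "search (Suc n) k m path s (y # ys) =
    ((case place m (hd path) y s of
        None \<Rightarrow> True
      | Some m' \<Rightarrow>
        if y \<in> set path then
          (if even (length (takeWhile (\<lambda>z. z \<noteq> y) path)) then
             if k = 8 then complete pairs m' else False
           else True)
        else search n (max k (Suc y)) m' (y # path) (\<not> s) [0..<min 8 (Suc (max k (Suc y)))])
     \<and> search (Suc n) k m path s ys)"

text \<open>Extracts the branch of one candidate \<open>y\<close> from the conjunction over all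
  candidates. Exhausting the bound makes \<open>search\<close> false, so a successful search has
  some bound left for each branch it enters.\<close>

lemma searchD:
  assumes "search n k m path s ys" "y \<in> set ys" "place m (hd path) y s = Some m'"
  shows "y \<in> set path \<Longrightarrow> even (length (takeWhile (\<lambda>z. z \<noteq> y) path)) \<Longrightarrow> k = 8 \<and> complete pairs m'"
    and "y \<notin> set path \<Longrightarrow>
      \<exists>n. search n (max k (Suc y)) m' (y # path) (\<not> s) [0..<min 8 (Suc (max k (Suc y)))]"
proof -
  have *: "\<exists>n'. case place m (hd path) y s of
        None \<Rightarrow> True
      | Some m' \<Rightarrow>
        if y \<in> set path then
          (if even (length (takeWhile (\<lambda>z. z \<noteq> y) path)) then
             if k = 8 then complete pairs m' else False
           else True)
        else search n' (max k (Suc y)) m' (y # path) (\<not> s) [0..<min 8 (Suc (max k (Suc y)))]"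
    using assms(1,2)
  proof (induction ys)
    case (Cons z ys)
    obtain n' where n: "n = Suc n'" using Cons.prems(1) by (cases n) auto
    show ?case
    proof (cases "z = y")
      case True
      show ?thesis
        using Cons.prems(1) unfolding n True search.simps by (intro exI[of _ n']) (erule conjunct1)
    next
      case False
      then show ?thesis using Cons n by simp
    qed
  qed simp
  show "y \<in> set path \<Longrightarrow> even (length (takeWhile (\<lambda>z. z \<noteq> y) path)) \<Longrightarrow> k = 8 \<and> complete pairs m'"
    using * assms(3) by (simp split: if_splits)
  show "y \<notin> set path \<Longrightarrow>
      \<exists>n. search n (max k (Suc y)) m' (y # path) (\<not> s) [0..<min 8 (Suc (max k (Suc y)))]"
    using * assms(3) by simp
qed

lemma catalogue_triangle_free:
  "\<forall>h \<in> set catalogue. wf_table h \<and> (\<forall>i<8. h ! i ! i = None) \<and>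
    (\<forall>i<8. \<forall>j<8. h ! i ! j = None \<or> \<not> common (h ! i) (h ! j))"
  unfolding wf_table_def by code_simp

section \<open>Soundness of the search\<close>

context coloured_graph
begin

definition in_catalogue :: bool where
  "in_catalogue \<longleftrightarrow> (\<exists>h \<in> set catalogue. \<exists>f. bij_betw f V {..<8} \<and>
    (\<forall>u\<in>V. \<forall>v\<in>V. (\<exists>s. R s u v) \<longleftrightarrow> h ! f u ! f v \<noteq> None))"

lemma recognised_in_catalogue:
  assumes "recognised m catalogue" "wf_table m" "distinct vs" "length vs = 8" "set vs = V"
    and adj: "\<And>i j. i < 8 \<Longrightarrow> j < 8 \<Longrightarrow> (\<exists>t. R t (vs ! i) (vs ! j)) \<longleftrightarrow> m ! i ! j \<noteq> None"
  shows in_catalogue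
proof -
  obtain h where h: "h \<in> set catalogue" "embeds m h [] [0..<8]"
    using recognised_sound[OF assms(1)] by blast
  have diag: "m ! i ! i = None" if "i < 8" for i
    using adj[OF that that] R_irrefl by blast
  obtain q where q: "length q = 8" "distinct q" "set q \<subseteq> {..<8}"
    "\<And>i j. i < 8 \<Longrightarrow> j < 8 \<Longrightarrow> m ! i ! j = None \<longleftrightarrow> h ! (q ! i) ! (q ! j) = None"
    using embeds_iso[OF h(2) assms(2)] catalogue_triangle_free h(1) diag by metis
  have "set q = {..<8}"
    using q distinct_card[of q] by (intro card_subset_eq) auto
  then have bq: "bij_betw ((!) q) {..<8} {..<8}" using q by (intro bij_betw_nth) auto
  have bvs: "bij_betw ((!) vs) {..<8} V" using assms by (intro bij_betw_nth) auto
  define g where "g = inv_into {..<8} ((!) vs)"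
  have bg: "bij_betw g V {..<8}" unfolding g_def by (rule bij_betw_inv_into[OF bvs])
  have g: "g u < 8 \<and> vs ! g u = u" if "u \<in> V" for u
  proof
    show "g u < 8" using bij_betw_apply[OF bg that] by simp
    show "vs ! g u = u" unfolding g_def by (rule bij_betw_inv_into_right[OF bvs that])
  qed
  have "bij_betw ((!) q \<circ> g) V {..<8}" by (rule bij_betw_trans[OF bg bq])
  moreover have "(\<exists>s. R s u v) \<longleftrightarrow> h ! (((!) q \<circ> g) u) ! (((!) q \<circ> g) v) \<noteq> None"
    if "u \<in> V" "v \<in> V" for u v
    using adj[of "g u" "g v"] q(4)[of "g u" "g v"] g[OF that(1)] g[OF that(2)] by auto
  ultimately show ?thesis unfolding in_catalogue_def using h(1) by blast
qed

text \<open>The actual graph singles out one branch, the one that adds exactly its edges. Invariant: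
  every edge is either in the table already or among the pairs still to be decided.\<close>

lemma complete_sound:
  assumes "complete ps m" "fits (\<lambda>_ u v. \<exists>t. R t u v) m vs" "set ps \<subseteq> {..<8} \<times> {..<8}"
    and "\<And>i j. i < j \<Longrightarrow> j < 8 \<Longrightarrow> \<exists>t. R t (vs ! i) (vs ! j) \<Longrightarrow> m ! i ! j \<noteq> None \<or> (i, j) \<in> set ps"
    and vs: "distinct vs" "length vs = 8" "set vs = V"
  shows in_catalogue
  using assms(1-4)
proof (induction ps arbitrary: m)
  case Nil
  have wf: "wf_table m" using Nil by (simp add: fits_def)
  have "(\<exists>t. R t (vs ! i) (vs ! j)) \<longleftrightarrow> m ! i ! j \<noteq> None" if "i < 8" "j < 8" for i j
  proof
    assume t: "\<exists>t. R t (vs ! i) (vs ! j)"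
    then have t': "\<exists>t. R t (vs ! j) (vs ! i)" using R_sym by blast
    have "i \<noteq> j" using t R_irrefl by blast
    then show "m ! i ! j \<noteq> None"
      using Nil(4)[OF _ _ t] Nil(4)[OF _ _ t'] that wf_tableD(3)[OF wf that]
      by (cases i j rule: linorder_cases) auto
  next
    assume "m ! i ! j \<noteq> None"
    then show "\<exists>t. R t (vs ! i) (vs ! j)" using Nil(2) that unfolding fits_def by blast
  qed
  then show ?case using Nil(1) wf vs by (intro recognised_in_catalogue) auto
next
  case (Cons e ps)
  obtain i j where e: "e = (i, j)" by (cases e)
  note prems = Cons.prems[unfolded e]
  have ij: "i < 8" "j < 8" "set ps \<subseteq> {..<8} \<times> {..<8}" using prems(3) by auto
  show ?case
  proof (cases "m ! i ! j = None \<and> (\<exists>t. R t (vs ! i) (vs ! j))")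
    case True
    then obtain t where t: "R t (vs ! i) (vs ! j)" by blast
    then have nc: "\<not> common (m ! i) (m ! j)"
      using fits_not_common[OF prems(2) _ ij(1,2)] by blast
    have wf: "wf_table m" using prems(2) by (simp add: fits_def)
    have "complete ps (join m i j True)" using prems(1) True nc by simp
    moreover have "fits (\<lambda>_ u v. \<exists>t. R t u v) (join m i j True) vs"
      using ij vs t R_sym[OF t] by (intro fits_join[OF prems(2)]) auto
    moreover have "join m i j True ! a ! b \<noteq> None \<or> (a, b) \<in> set ps"
      if "a < b" "b < 8" "\<exists>t. R t (vs ! a) (vs ! b)" for a b
    proof -
      have "m ! a ! b \<noteq> None \<or> (a = i \<and> b = j) \<or> (a, b) \<in> set ps"
        using prems(4)[OF that] by simp
      then show ?thesis
        unfolding join_nth[OF wf ij(1,2)] by (metis option.distinct(1))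
    qed
    ultimately show ?thesis by (intro Cons.IH[OF _ _ ij(3)])
  next
    case False
    have "complete ps m" using prems(1) by (auto split: if_splits)
    moreover have "m ! a ! b \<noteq> None \<or> (a, b) \<in> set ps"
      if "a < b" "b < 8" "\<exists>t. R t (vs ! a) (vs ! b)" for a b
      using prems(4)[OF that] False that(3) by auto
    ultimately show ?thesis by (intro Cons.IH[OF _ prems(2) ij(3)])
  qed
qed

text \<open>The search runs alongside the lollipop. A vertex not met before gets the next free
  label, so the labels in use and one more are all the candidates. Since \<open>search\<close> fails
  if a lollipop closes with fewer than 8 labels in use, \<open>vs\<close> must exhaust
  \<open>V\<close> at that point and \<open>complete\<close> applies.\<close>

lemma search_sound:
  assumes "lollipop R s us" "distinct vs" "set vs \<subseteq> V" "card V \<le> 8" "fits R m vs"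
    "us = map ((!) vs) path" "set path \<subseteq> {..<length vs}"
    "search n (length vs) m path s [0..<min 8 (Suc (length vs))]"
  shows in_catalogue
  using assms
proof (induction arbitrary: vs m path n rule: lollipop.induct)
  case (close s u w us)
  have len: "length vs \<le> 8"
    using close.prems(1-3) distinct_card[of vs] card_mono[OF finite_V, of "set vs"] by simp
  have path: "path \<noteq> []" "hd path < length vs" "vs ! hd path = u"
    using close.prems(5,6) by (cases path; simp)+
  obtain y where y: "y \<in> set path" "w = vs ! y" using close.hyps(2) close.prems(5) by auto
  then have "y < length vs" using close.prems(6) by auto
  then obtain m' where m': "place m (hd path) y s = Some m'" "fits R m' vs"
    using place_fits[OF close.prems(4), of "hd path" y s] path len y(2) close.hyps(1) by auto
  \<comment> \<open>As \<open>vs\<close> is distinct, vertices and labels correspond one to one, and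
    the parity test gives the same answer on both.\<close>
  have eq: "vs ! x \<noteq> w \<longleftrightarrow> x \<noteq> y" if "x \<in> set path" for x
    using nth_eq_iff_index_eq[OF close.prems(1)] that close.prems(6) \<open>y < length vs\<close> y(2) by auto
  have "takeWhile (\<lambda>x. x \<noteq> w) (u # us) = map ((!) vs) (takeWhile (\<lambda>z. z \<noteq> y) path)"
    unfolding close.prems(5) takeWhile_map
    by (rule arg_cong, rule takeWhile_cong) (auto simp: eq)
  then have "even (length (takeWhile (\<lambda>z. z \<noteq> y) path))" using close.hyps(3) by (metis length_map)
  moreover have "y \<in> set [0..<min 8 (Suc (length vs))]"
    unfolding set_upt atLeastLessThan_iff min_less_iff_conj using \<open>y < length vs\<close> len by auto
  ultimately have k: "length vs = 8" "complete pairs m'"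
    using searchD(1)[OF close.prems(7) _ m'(1) y(1)] by blast+
  have "set vs = V"
    using close.prems k distinct_card[of vs] card_mono[OF finite_V, of "set vs"]
    by (intro card_subset_eq[OF finite_V]) auto
  with k m'(2) close.prems(1) show ?case
    by (intro complete_sound[of pairs m' vs]) (auto simp: set_pairs elim: fits_mono)
next
  case (step s u w us)
  have path: "path \<noteq> []" "hd path < length vs" "vs ! hd path = u"
    using step.prems(5,6) by (cases path; simp)+
  \<comment> \<open>Either \<open>w\<close> already has a label and \<open>vs'\<close> is
    \<open>vs\<close>, or \<open>w\<close> is appended with the label
    \<open>length vs\<close>.\<close>
  obtain vs' y where vs': "distinct vs'" "set vs' \<subseteq> V" "fits R m vs'" "y < length vs'" "w = vs' ! y"
    "y \<le> length vs" "length vs' = max (length vs) (Suc y)" "\<And>i. i < length vs \<Longrightarrow> vs' ! i = vs ! i"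
  proof (cases "w \<in> set vs")
    case True
    then obtain y where "y < length vs" "w = vs ! y" by (metis in_set_conv_nth)
    then show ?thesis using step.prems by (intro that[of vs y]) auto
  next
    case False
    then show ?thesis
      using step.prems(1-6) R_in[OF R_sym[OF step.hyps(1)]]
      by (intro that[of "vs @ [w]" "length vs"]) (auto simp: fits_snoc nth_append)
  qed
  have len: "length vs' \<le> 8"
    using vs'(1,2) step.prems(3) distinct_card[of vs'] card_mono[OF finite_V, of "set vs'"] by simp
  have us: "u # us = map ((!) vs') path"
    unfolding step.prems(5) using step.prems(6) vs'(8) by auto
  have "R s (vs' ! hd path) (vs' ! y)" using path vs'(5,8) step.hyps(1) by simp
  moreover have "hd path < length vs'" using path(2) vs'(7) by simp
  ultimately obtain m' where m': "place m (hd path) y s = Some m'" "fits R m' vs'"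
    using place_fits[OF vs'(3), of "hd path" y s] len vs'(4) by auto
  have "y \<notin> set path" using step.hyps(2) vs'(5) unfolding us by auto
  moreover have "y \<in> set [0..<min 8 (Suc (length vs))]"
    unfolding set_upt atLeastLessThan_iff min_less_iff_conj using vs'(4,6,7) len by simp
  ultimately obtain n' where
    n': "search n' (length vs') m' (y # path) (\<not> s) [0..<min 8 (Suc (length vs'))]"
    using searchD(2)[OF step.prems(7) _ m'(1)] vs'(7) by metis
  show ?case
  proof (rule step.IH[OF vs'(1,2) step.prems(3) m'(2) _ _ n'])
    show "w # u # us = map ((!) vs') (y # path)" using us vs'(5) by simp
    show "set (y # path) \<subseteq> {..<length vs'}" using step.prems(6) vs'(4,6,7) by auto
  qed
qed

end

text \<open>For odd \<open>n\<close> the colours alternate around the cycle except at the label 0,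
  where both edges have colour \<open>True\<close>.\<close>

definition cycle_table :: "nat \<Rightarrow> table" where
  "cycle_table n = table_of (map (\<lambda>i. (i, (if Suc i = n then 0 else Suc i), even i)) [0..<n])"

text \<open>The lollipop starts at the exceptional label 0 with an edge of colour
  \<open>False\<close>. The bound 8 suffices because every step before the closing one adds a new
  label to the path.\<close>

lemma search_cycle_5: "search 8 5 (cycle_table 5) [0] False [0..<min 8 (Suc 5)]"
  by code_simp

lemma search_cycle_7: "search 8 7 (cycle_table 7) [0] False [0..<min 8 (Suc 7)]"
  by code_simp

lemma coloured_graph_flip:
  assumes "coloured_graph V R"
  shows "coloured_graph V (\<lambda>s. R (\<not> s))"
proof -
  interpret coloured_graph V R by fact
  show ?thesis
    by unfold_locales (use finite_V R_in R_sym R_unique R_no_triangle in blast)+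
qed

context coloured_graph
begin

text \<open>The cycle has odd length at most 8. Length 1 would be a loop and length 3 a triangle, so
  one of the two evaluated searches applies.\<close>

lemma cycle_lollipop_in_catalogue:
  assumes walk: "awalk R True (z # q @ [z])" and cycle: "distinct (z # q)" "even (length q)"
    and lol: "lollipop R False [z]" and card: "card V \<le> 8"
  shows in_catalogue
proof -
  define vs where "vs = z # q"
  define n where "n = length vs"
  have nth: "(z # q @ [z]) ! i = vs ! (if i = n then 0 else i)" if "i \<le> n" for i
    using that by (auto simp: vs_def n_def nth_Cons nth_append split: nat.splits)
  have edge: "R (even i) (vs ! i) (vs ! (if Suc i = n then 0 else Suc i))" if "i < n" for i
    using awalk_nth[OF walk, of i] nth[of i] nth[of "Suc i"] that
    by (auto simp: n_def vs_def split: if_splits)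
  have "set vs \<subseteq> V"
  proof
    fix x assume "x \<in> set vs"
    then obtain i where "i < n" "x = vs ! i" unfolding n_def by (metis in_set_conv_nth)
    then show "x \<in> V" using R_in edge by blast
  qed
  have "n \<le> 8"
    using \<open>set vs \<subseteq> V\<close> card cycle(1) distinct_card[of vs] card_mono[OF finite_V, of "set vs"]
    by (simp add: n_def vs_def)
  moreover have "odd n" using cycle(2) by (simp add: n_def vs_def)
  moreover have "n \<noteq> 1"
  proof
    assume "n = 1"
    with edge[of 0] R_irrefl show False by simp
  qed
  moreover have "n \<noteq> 3"
  proof
    assume "n = 3"
    with edge[of 0] edge[of 1] edge[of 2] R_sym R_no_triangle show False
      by (simp add: numeral_2_eq_2 numeral_3_eq_3) blast
  qed
  ultimately have "n = 5 \<or> n = 7" by presburger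
  then have "search 8 n (cycle_table n) [0] False [0..<min 8 (Suc n)]"
    using search_cycle_5 search_cycle_7 by blast
  moreover have "fits R (cycle_table n) vs"
    unfolding cycle_table_def
  proof (rule fits_table_of)
    show "length vs \<le> 8" using \<open>n \<le> 8\<close> by (simp add: n_def)
    fix i j s
    assume "(i, j, s) \<in> set (map (\<lambda>i. (i, if Suc i = n then 0 else Suc i, even i)) [0..<n])"
    then have ij: "i < n" "j = (if Suc i = n then 0 else Suc i)" "s = even i" by auto
    then have "j < n" by auto
    with ij show "i < length vs \<and> j < length vs \<and> R s (vs ! i) (vs ! j) \<and> R s (vs ! j) (vs ! i)"
      using edge[OF ij(1)] R_sym by (simp add: n_def)
  qed
  ultimately show ?thesis
    using lol cycle(1) \<open>set vs \<subseteq> V\<close> card unfolding n_def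
    by (intro search_sound[of False "[z]" vs _ "[0]"]) (auto simp: vs_def)
qed

text \<open>If the repeated colour at \<open>z\<close> is \<open>False\<close>, the two colours are
  exchanged; \<open>in_catalogue\<close> depends only on the underlying graph and is not
  affected.\<close>

lemma unextendable_in_catalogue:
  assumes unextendable "card V \<le> 8"
  shows in_catalogue
proof -
  obtain t z q where walk: "awalk R t (z # q @ [z])" "distinct (z # q)" "even (length q)"
    and lol: "lollipop R (\<not> t) [z]"
    using unextendable_cycle_lollipop[OF assms(1)] .
  show ?thesis
  proof (cases t)
    case True
    with walk lol assms(2) show ?thesis by (intro cycle_lollipop_in_catalogue[of z q]) auto
  next
    case False
    interpret flip: coloured_graph V "\<lambda>s. R (\<not> s)"
      by (rule coloured_graph_flip) unfold_locales
    have "flip.in_catalogue"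
      using awalk_flip[OF walk(1)] lollipop_flip[OF lol] False walk(2,3) assms(2)
      by (intro flip.cycle_lollipop_in_catalogue[of z q]) auto
    moreover have "(\<exists>s. R (\<not> s) u v) \<longleftrightarrow> (\<exists>s. R s u v)" for u v
      by (auto simp: ex_bool_eq)
    ultimately show ?thesis unfolding in_catalogue_def flip.in_catalogue_def by simp
  qed
qed

end

section \<open>Graphs with eight marked vertices\<close>

lemma coloured_graph_of:
  assumes "simple_graph N" "triangle_free N"
  shows "coloured_graph (verts N) (\<lambda>s u v. {u, v} \<in> edges N \<and> c {u, v} = s)"
proof
  show "finite (verts N)" using assms(1) by (simp add: simple_graph_def)
qed (use assms in \<open>auto simp: simple_graph_def triangle_free_def triangle_def insert_commute\<close>)

lemma cone_edges:
  "{Some u, Some v} \<in> edges (cone N) \<longleftrightarrow> {u, v} \<in> edges N"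
  "{None, Some v} \<in> edges (cone N) \<longleftrightarrow> v \<in> verts N"
  "{None} \<notin> edges (cone N)"
proof -
  have "Some ` e = {Some u, Some v} \<longleftrightarrow> e = {u, v}" for e :: "'a set"
    using inj_image_eq_iff[of Some e "{u, v}"] by simp
  then have "{Some u, Some v} \<in> (`) Some ` edges N \<longleftrightarrow> {u, v} \<in> edges N"
    by (metis (no_types, lifting) image_iff)
  then show "{Some u, Some v} \<in> edges (cone N) \<longleftrightarrow> {u, v} \<in> edges N"
    by (auto simp: cone_def)
  have none: "Some ` e \<noteq> insert None A" for e :: "'a set" and A by blast
  show "{None, Some v} \<in> edges (cone N) \<longleftrightarrow> v \<in> verts N"
    using none by (auto simp: cone_def doubleton_eq_iff image_iff)
  have "{None, Some u} \<noteq> {None}" for u :: 'a by auto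
  then show "{None} \<notin> edges (cone N)"
    using none by (simp add: cone_def image_iff) metis
qed

text \<open>Every colouring of a triangle-free graph is free, and all triangles of its cone pass
  through the apex. Extending a colouring thus amounts to choosing colours \<open>x\<close> of the
  apex edges.\<close>

lemma all_marked_iff:
  fixes N :: "'a graph"
  assumes "simple_graph N" "triangle_free N"
  shows "all_marked N \<longleftrightarrow>
    (\<exists>c :: 'a set \<Rightarrow> bool. \<forall>x. \<exists>u v. {u, v} \<in> edges N \<and> x u = c {u, v} \<and> x v = c {u, v})"
proof -
  have "(\<exists>c'. free33_coloring (cone N) c' \<and> (\<forall>e\<in>edges N. c' (Some ` e) = c e)) \<longleftrightarrow>
      (\<exists>x. \<forall>u v. {u, v} \<in> edges N \<longrightarrow> \<not> (x u = c {u, v} \<and> x v = c {u, v}))" (is "?L \<longleftrightarrow> ?R") for c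
  proof
    assume ?L
    then obtain c' where free: "free33_coloring (cone N) c'"
      and ext: "\<And>e. e \<in> edges N \<Longrightarrow> c' (Some ` e) = c e" by blast
    have "\<not> (c' {None, Some u} = c {u, v} \<and> c' {None, Some v} = c {u, v})"
      if uv: "{u, v} \<in> edges N" for u v
    proof -
      have "triangle (cone N) None (Some u) (Some v)"
        using uv assms(1) by (auto simp: triangle_def cone_edges simple_graph_def)
      then have "\<not> (c' {None, Some u} = c' {Some u, Some v} \<and> c' {Some u, Some v} = c' {None, Some v})"
        using free unfolding free33_coloring_def by blast
      then show ?thesis using ext[OF uv] by auto
    qed
    then show ?R by (intro exI[of _ "\<lambda>u. c' {None, Some u}"]) blast
  next
    assume ?R
    then obtain x where x: "\<And>u v. {u, v} \<in> edges N \<Longrightarrow> \<not> (x u = c {u, v} \<and> x v = c {u, v})"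
      by blast
    define c' where "c' e = (if None \<in> e then \<exists>u. Some u \<in> e \<and> x u else c (the ` e))" for e
    have c': "c' {None, Some u} = x u" "c' {Some u, None} = x u" "c' {Some u, Some v} = c {u, v}"
      "c' (Some ` e) = c e" for u v e
      by (auto simp: c'_def image_image)
    have "\<not> (triangle (cone N) a b d \<and> c' {a, b} = c' {b, d} \<and> c' {b, d} = c' {a, d})" for a b d
    proof
      assume t: "triangle (cone N) a b d \<and> c' {a, b} = c' {b, d} \<and> c' {b, d} = c' {a, d}"
      note e = cone_edges cone_edges(2)[unfolded insert_commute[of None]]
      have "\<not> triangle N u v w" for u v w using assms(2) by (simp add: triangle_free_def)
      then show False
        using t x unfolding triangle_def
        by (cases a; cases b; cases d) (simp_all add: e c', blast+)
    qed
    then have "free33_coloring (cone N) c'" unfolding free33_coloring_def by blast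
    then show ?L using c'(4) by blast
  qed
  moreover have "free33_coloring N c" for c
    using assms(2) by (auto simp: free33_coloring_def triangle_free_def)
  ultimately show ?thesis unfolding all_marked_def by auto
qed

definition graph_of :: "table \<Rightarrow> nat graph" where
  "graph_of h = \<lparr>verts = {..<8}, edges = {{i, j} |i j. i < 8 \<and> j < 8 \<and> h ! i ! j \<noteq> None}\<rparr>"

lemma edge_graph_of:
  assumes "wf_table h"
  shows "{i, j} \<in> edges (graph_of h) \<longleftrightarrow> i < 8 \<and> j < 8 \<and> h ! i ! j \<noteq> None"
proof
  assume "{i, j} \<in> edges (graph_of h)"
  then obtain a b where "{i, j} = {a, b}" "a < 8" "b < 8" "h ! a ! b \<noteq> None"
    by (auto simp: graph_of_def)
  then show "i < 8 \<and> j < 8 \<and> h ! i ! j \<noteq> None"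
    using wf_tableD(3)[OF assms, of a b] by (metis doubleton_eq_iff)
qed (auto simp: graph_of_def)

text \<open>Stated for at most 8 vertices, because the conclusion then forces exactly 8; this is the
  source of the bound on the minimum degree.\<close>

lemma unextendable_isomorphic:
  fixes N :: "'a graph" and c :: "'a set \<Rightarrow> bool"
  assumes "simple_graph N" "triangle_free N" "card (verts N) \<le> 8"
    and "\<And>x. \<exists>u v. {u, v} \<in> edges N \<and> x u = c {u, v} \<and> x v = c {u, v}"
  shows "\<exists>h \<in> set catalogue. isomorphic N (graph_of h)"
proof -
  interpret coloured_graph "verts N" "\<lambda>s u v. {u, v} \<in> edges N \<and> c {u, v} = s"
    by (rule coloured_graph_of) fact+
  have unextendable unfolding unextendable_def using assms(4) by fastforce
  then have in_catalogue using assms(3) by (rule unextendable_in_catalogue)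
  then obtain h f where h: "h \<in> set catalogue" and f: "bij_betw f (verts N) {..<8}"
    and adj: "\<And>u v. u \<in> verts N \<Longrightarrow> v \<in> verts N \<Longrightarrow> {u, v} \<in> edges N \<longleftrightarrow> h ! f u ! f v \<noteq> None"
    unfolding in_catalogue_def by auto
  have wf: "wf_table h" using h catalogue_triangle_free by blast
  have "f u < 8" if "u \<in> verts N" for u using bij_betw_apply[OF f that] by simp
  then have "isomorphic N (graph_of h)"
    unfolding isomorphic_def
    by (intro exI[of _ f]) (simp add: edge_graph_of[OF wf] adj, simp add: graph_of_def f)
  with h show ?thesis by blast
qed

text \<open>In \<open>table_of\<close> a later edge could overwrite an earlier one; evaluation shows
  that no listed colour is lost.\<close>

lemma catalogue_coloured_edges:
  "\<forall>e \<in> set marked_edges. \<forall>(i, j, s) \<in> set (coloured_edges e).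
    i < 8 \<and> j < 8 \<and> table_of (coloured_edges e) ! i ! j = Some s"
  by code_simp

text \<open>Each of the seven lists is an unsatisfiable system of two-literal clauses in the values
  of \<open>x\<close>, refuted by propositional reasoning.\<close>

lemma marked_edges_unextendable:
  fixes x :: "nat \<Rightarrow> bool"
  assumes "e \<in> set marked_edges"
  shows "\<exists>(i, j, s) \<in> set (coloured_edges e). x i = s \<and> x j = s"
  using assms unfolding marked_edges_def coloured_edges_def by simp (elim disjE; simp; blast)

lemma marked8_catalogue:
  assumes "h \<in> set catalogue"
  shows "marked8 (graph_of h)"
proof -
  have h: "wf_table h" "\<And>i. i < 8 \<Longrightarrow> h ! i ! i = None"
    "\<And>i j. i < 8 \<Longrightarrow> j < 8 \<Longrightarrow> h ! i ! j = None \<or> \<not> common (h ! i) (h ! j)"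
    using assms catalogue_triangle_free by blast+
  note edge = edge_graph_of[OF h(1)]
  have simple: "simple_graph (graph_of h)"
    unfolding simple_graph_def
  proof (intro conjI ballI)
    fix e assume e: "e \<in> edges (graph_of h)"
    then obtain i j where ij: "e = {i, j}" "i < 8" "j < 8" "h ! i ! j \<noteq> None"
      by (auto simp: graph_of_def)
    with h(2) have "i \<noteq> j" by metis
    with ij show "card e = 2" "e \<subseteq> verts (graph_of h)" by (auto simp: graph_of_def)
  qed (simp add: graph_of_def)
  have "triangle_free (graph_of h)"
    unfolding triangle_free_def
  proof clarify
    fix i j k assume "triangle (graph_of h) i j k"
    then have "i < 8" "j < 8" "k < 8" "h ! i ! j \<noteq> None" "h ! j ! k \<noteq> None" "h ! i ! k \<noteq> None"
      by (simp_all add: triangle_def edge)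
    then show False
      using h(3)[of i j] by (metis common_iff wf_tableD(2)[OF h(1)])
  qed
  moreover have "all_marked (graph_of h)"
  proof -
    define c where "c e \<longleftrightarrow> (\<exists>i<8. \<exists>j<8. e = {i, j} \<and> h ! i ! j = Some True)" for e
    have c: "c {i, j} \<longleftrightarrow> h ! i ! j = Some True" if "i < 8" "j < 8" for i j
      unfolding c_def using that wf_tableD(3)[OF h(1) that] by (metis doubleton_eq_iff)
    have "\<exists>u v. {u, v} \<in> edges (graph_of h) \<and> x u = c {u, v} \<and> x v = c {u, v}" for x
    proof -
      obtain e where e: "e \<in> set marked_edges" "h = table_of (coloured_edges e)"
        using assms by (auto simp: catalogue_def)
      obtain i j s where "(i, j, s) \<in> set (coloured_edges e)" "x i = s" "x j = s"
        using marked_edges_unextendable[OF e(1), of x] by auto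
      moreover from this have "i < 8" "j < 8" "h ! i ! j = Some s"
        using catalogue_coloured_edges e by blast+
      ultimately show ?thesis
        by (intro exI[of _ i] exI[of _ j]) (simp add: edge c)
    qed
    then show ?thesis
      unfolding all_marked_iff[OF simple \<open>triangle_free (graph_of h)\<close>] by blast
  qed
  ultimately show ?thesis using simple by (simp add: marked8_def graph_of_def)
qed

section \<open>An isomorphism invariant that separates the seven graphs\<close>

definition nbr_degree_sums :: "'a graph \<Rightarrow> nat set" where
  "nbr_degree_sums N = (\<lambda>v. \<Sum>u \<in> neighbors N v. degree N u) ` verts N"

lemma isomorphic_nbr_degree_sums:
  assumes "isomorphic G H"
  shows "nbr_degree_sums G = nbr_degree_sums H"
proof -
  obtain f where f: "bij_betw f (verts G) (verts H)"
    and adj: "\<And>u v. u \<in> verts G \<Longrightarrow> v \<in> verts G \<Longrightarrow> {u, v} \<in> edges G \<longleftrightarrow> {f u, f v} \<in> edges H"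
    using assms unfolding isomorphic_def by blast
  have nbr: "neighbors H (f v) = f ` neighbors G v" if "v \<in> verts G" for v
  proof -
    have "neighbors H (f v) = {w \<in> f ` verts G. {w, f v} \<in> edges H}"
      unfolding neighbors_def bij_betw_imp_surj_on[OF f] ..
    also have "\<dots> = f ` neighbors G v" using adj[OF _ that] by (auto simp: neighbors_def)
    finally show ?thesis .
  qed
  have inj: "inj_on f (neighbors G v)" for v
    using f by (auto simp: neighbors_def bij_betw_def intro: inj_on_subset)
  have deg: "degree H (f v) = degree G v" if "v \<in> verts G" for v
    by (simp add: degree_def nbr[OF that] card_image[OF inj])
  have "(\<Sum>u \<in> neighbors H (f v). degree H u) = (\<Sum>u \<in> neighbors G v. degree G u)"
    if "v \<in> verts G" for v
    unfolding nbr[OF that] sum.reindex[OF inj]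
    by (rule sum.cong) (auto simp: neighbors_def deg)
  then have "nbr_degree_sums G = (\<lambda>v. \<Sum>u \<in> neighbors H (f v). degree H u) ` verts G"
    unfolding nbr_degree_sums_def by (intro image_cong) auto
  also have "\<dots> = nbr_degree_sums H"
    unfolding nbr_degree_sums_def bij_betw_imp_surj_on[OF f, symmetric] by (simp add: image_image)
  finally show ?thesis .
qed

definition table_sums :: "table \<Rightarrow> nat list" where
  "table_sums h = map (\<lambda>i. sum_list (map (\<lambda>j. row_degree (h ! j))
     (filter (\<lambda>j. h ! i ! j \<noteq> None) [0..<8]))) [0..<8]"

lemma row_degree_card: "row_degree xs = card {j. j < length xs \<and> xs ! j \<noteq> None}"
proof -
  have "row_degree xs = length (filter (\<lambda>x. x \<noteq> None) xs)"
    by (induction xs rule: row_degree.induct) auto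
  then show ?thesis by (simp only: length_filter_conv_card)
qed

lemma nbr_degree_sums_graph_of:
  assumes "wf_table h"
  shows "nbr_degree_sums (graph_of h) = set (table_sums h)"
proof -
  have nbr: "neighbors (graph_of h) i = {j. j < 8 \<and> h ! i ! j \<noteq> None}" if "i < 8" for i
    unfolding neighbors_def edge_graph_of[OF assms]
    using that wf_tableD(3)[OF assms that] by (auto simp: graph_of_def)
  have deg: "degree (graph_of h) i = row_degree (h ! i)" if "i < 8" for i
    by (simp add: degree_def nbr[OF that] row_degree_card wf_tableD(2)[OF assms that])
  have "(\<Sum>j \<in> neighbors (graph_of h) i. degree (graph_of h) j) =
      sum_list (map (\<lambda>j. row_degree (h ! j)) (filter (\<lambda>j. h ! i ! j \<noteq> None) [0..<8]))"
    if "i < 8" for i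
    unfolding nbr[OF that]
    by (subst sum_list_distinct_conv_sum_set) (auto simp: deg intro!: sum.cong)
  then show ?thesis
    unfolding nbr_degree_sums_def table_sums_def set_map
    by (intro image_cong) (auto simp: graph_of_def)
qed

lemma distinct_table_sums: "distinct (map (\<lambda>h. set (table_sums h)) catalogue)"
  by code_simp

lemma length_catalogue: "length catalogue = 7"
  by (simp add: catalogue_def marked_edges_def)

text \<open>The catalogue, with indices shifted to start at 1, is a witness that makes the choice in
  \<open>N8\<close> legitimate: evaluation of the invariant separates its members, and the search
  shows that nothing is missing.\<close>

lemma lists_marked8_N8: "lists_marked8 N8"
proof -
  define F where "F i = graph_of (catalogue ! (i - 1))" for i
  have in_cat: "catalogue ! (i - 1) \<in> set catalogue" if "i \<in> {1..7}" for i
    using that by (intro nth_mem) (auto simp: length_catalogue)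
  have "\<not> isomorphic (F i) (F j)" if "i \<in> {1..7}" "j \<in> {1..7}" "i \<noteq> j" for i j
  proof
    assume "isomorphic (F i) (F j)"
    then have "set (table_sums (catalogue ! (i - 1))) = set (table_sums (catalogue ! (j - 1)))"
      using isomorphic_nbr_degree_sums nbr_degree_sums_graph_of in_cat that(1,2)
        catalogue_triangle_free unfolding F_def by metis
    then have "i - 1 = j - 1"
      using nth_eq_iff_index_eq[OF distinct_table_sums, of "i - 1" "j - 1"] that
      by (auto simp: length_catalogue)
    then show False using that by auto
  qed
  moreover have "\<exists>i\<in>{1..7}. isomorphic N (F i)" if N: "marked8 N" for N :: "nat graph"
  proof -
    have N': "simple_graph N" "triangle_free N" "card (verts N) \<le> 8" "all_marked N"
      using N by (simp_all add: marked8_def)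
    from iffD1[OF all_marked_iff[OF N'(1,2)] N'(4)] obtain c :: "nat set \<Rightarrow> bool"
      where c: "\<forall>x. \<exists>u v. {u, v} \<in> edges N \<and> x u = c {u, v} \<and> x v = c {u, v}"
      by blast
    from unextendable_isomorphic[OF N'(1-3) spec[OF c]]
    obtain h where h: "h \<in> set catalogue" "isomorphic N (graph_of h)" by blast
    then obtain k where "k < 7" "h = catalogue ! k" by (metis in_set_conv_nth length_catalogue)
    with h(2) show ?thesis by (intro bexI[of _ "Suc k"]) (auto simp: F_def)
  qed
  ultimately have "lists_marked8 F"
    unfolding lists_marked8_def using marked8_catalogue in_cat F_def by simp
  then show ?thesis unfolding N8_def by (rule someI[of lists_marked8])
qed

section \<open>Neighbourhoods in minimal Ramsey graphs\<close>

lemma isomorphic_trans: "isomorphic G H \<Longrightarrow> isomorphic H K \<Longrightarrow> isomorphic G K"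
  unfolding isomorphic_def
proof (elim exE conjE)
  fix f g
  assume f: "bij_betw f (verts G) (verts H)" and g: "bij_betw g (verts H) (verts K)"
    and "\<forall>u\<in>verts G. \<forall>v\<in>verts G. {u, v} \<in> edges G \<longleftrightarrow> {f u, f v} \<in> edges H"
    and "\<forall>u\<in>verts H. \<forall>v\<in>verts H. {u, v} \<in> edges H \<longleftrightarrow> {g u, g v} \<in> edges K"
  then show "\<exists>f. bij_betw f (verts G) (verts K) \<and>
      (\<forall>u\<in>verts G. \<forall>v\<in>verts G. {u, v} \<in> edges G \<longleftrightarrow> {f u, f v} \<in> edges K)"
    using bij_betw_apply[OF f] by (intro exI[of _ "g \<circ> f"]) (auto intro: bij_betw_trans[OF f g])
qed

lemma isomorphic_card: "isomorphic G H \<Longrightarrow> card (verts G) = card (verts H)"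
  unfolding isomorphic_def using bij_betw_same_card by blast

lemma neighborhood_graph_edges:
  "{a, b} \<in> edges (neighborhood_graph G v) \<longleftrightarrow>
    {a, b} \<in> edges G \<and> a \<in> neighbors G v \<and> b \<in> neighbors G v"
  by (auto simp: neighborhood_graph_def induced_subgraph_def)

text \<open>The colouring \<open>c\<close> is a free colouring of \<open>G\<close> without
  \<open>v\<close>. A choice \<open>x\<close> that met no obstruction would colour the edges at
  \<open>v\<close>: triangles through \<open>v\<close> are harmless by the choice of
  \<open>x\<close>, all others by that of \<open>c\<close>, so \<open>G\<close> would not be
  Ramsey.\<close>

lemma minimal_neighborhood_unextendable:
  fixes G :: "'a graph"
  assumes "simple_graph G" "minimal_ramsey33 G" "v \<in> verts G"
  shows "\<exists>c :: 'a set \<Rightarrow> bool. \<forall>x. \<exists>a b. {a, b} \<in> edges (neighborhood_graph G v) \<and>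
    x a = c {a, b} \<and> x b = c {a, b}"
proof -
  define H where "H = induced_subgraph G (verts G - {v})"
  have "subgraph H G"
    using assms(1) by (auto simp: subgraph_def simple_graph_def H_def induced_subgraph_def)
  moreover have "H \<noteq> G"
  proof
    assume "H = G"
    then have "verts H = verts G" by simp
    then show False using assms(3) by (auto simp: H_def induced_subgraph_def)
  qed
  ultimately obtain c where c: "free33_coloring H c"
    using assms(2) unfolding minimal_ramsey33_def ramsey33_def by blast
  have "\<exists>a b. {a, b} \<in> edges (neighborhood_graph G v) \<and> x a = c {a, b} \<and> x b = c {a, b}" for x
  proof (rule ccontr)
    assume no: "\<not> ?thesis"
    \<comment> \<open>For an edge at \<open>v\<close>, the set \<open>e - {v}\<close> contains just
      the other end, whose value under \<open>x\<close> becomes the colour.\<close>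
    define c' where "c' e = (if v \<in> e then \<exists>u\<in>e - {v}. x u else c e)" for e
    have c': "c' {v, u} = x u" "c' {u, v} = x u" if "u \<noteq> v" for u
      using that by (auto simp: c'_def)
    have c'_c: "c' {a, b} = c {a, b}" if "a \<noteq> v" "b \<noteq> v" for a b
      using that by (auto simp: c'_def)
    have ends: "a \<in> verts G" "b \<in> verts G" "a \<noteq> b" if "{a, b} \<in> edges G" for a b
      using that assms(1) by (auto simp: simple_graph_def)
    have at_v: False if "{v, a} \<in> edges G" "{v, b} \<in> edges G" "{a, b} \<in> edges G"
      "x a = c {a, b}" "x b = c {a, b}" for a b
    proof -
      have "{a, b} \<in> edges (neighborhood_graph G v)"
        using that(1-3) ends by (auto simp: neighborhood_graph_edges neighbors_def insert_commute)
      then show False using no that(4,5) by blast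
    qed
    have off_v: False if "triangle G a b d" "a \<noteq> v" "b \<noteq> v" "d \<noteq> v"
      "c {a, b} = c {b, d}" "c {b, d} = c {a, d}" for a b d
    proof -
      have "triangle H a b d"
        using that ends by (auto simp: triangle_def H_def induced_subgraph_def)
      then show False using c that(5,6) unfolding free33_coloring_def by blast
    qed
    have "free33_coloring G c'"
      unfolding free33_coloring_def
    proof clarify
      fix a b d
      assume t: "triangle G a b d" and eq: "c' {a, b} = c' {b, d}" "c' {b, d} = c' {a, d}"
      then have e: "{a, b} \<in> edges G" "{b, d} \<in> edges G" "{a, d} \<in> edges G"
        by (auto simp: triangle_def)
      have ne: "a \<noteq> b" "b \<noteq> d" "a \<noteq> d" using e ends by auto
      consider "a = v" | "b = v" | "d = v" | "a \<noteq> v" "b \<noteq> v" "d \<noteq> v" by blast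
      then show False
      proof cases
        case 1
        then have nv: "b \<noteq> v" "d \<noteq> v" using ne by auto
        then have "x b = c {b, d}" "x d = c {b, d}"
          using eq c' c'_c[OF nv] unfolding 1 by metis+
        then show False using at_v[of b d] e 1 by blast
      next
        case 2
        then have nv: "a \<noteq> v" "d \<noteq> v" using ne by auto
        then have "x a = c {a, d}" "x d = c {a, d}"
          using eq c' c'_c[OF nv] unfolding 2 by metis+
        then show False using at_v[of a d] e 2 by (simp add: insert_commute)
      next
        case 3
        then have nv: "a \<noteq> v" "b \<noteq> v" using ne by auto
        then have "x a = c {a, b}" "x b = c {a, b}"
          using eq c' c'_c[OF nv] unfolding 3 by metis+
        then show False using at_v[of a b] e 3 by (simp add: insert_commute)
      next
        case 4
        show False
          using off_v[OF t 4] eq c'_c[OF 4(1,2)] c'_c[OF 4(2,3)] c'_c[OF 4(1,3)] by simp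
      qed
    qed
    then show False using assms(2) by (simp add: minimal_ramsey33_def ramsey33_def)
  qed
  then show ?thesis by blast
qed

text \<open>A triangle among the neighbours of \<open>v\<close> would form a clique of size 4
  together with \<open>v\<close>.\<close>

lemma neighborhood_triangle_free:
  assumes "simple_graph G" "clique_number G = 3" "v \<in> verts G"
  shows "triangle_free (neighborhood_graph G v)"
  unfolding triangle_free_def
proof clarify
  fix a b d assume "triangle (neighborhood_graph G v) a b d"
  then have e: "{a, b} \<in> edges G" "{b, d} \<in> edges G" "{a, d} \<in> edges G"
    "{a, v} \<in> edges G" "{b, v} \<in> edges G" "{d, v} \<in> edges G"
    by (auto simp: triangle_def neighborhood_graph_edges neighbors_def)
  have "card e = 2" "e \<subseteq> verts G" if "e \<in> edges G" for e
    using that assms(1) by (auto simp: simple_graph_def)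
  from this(1)[OF e(1)] this(1)[OF e(2)] this(1)[OF e(3)] this(1)[OF e(4)] this(1)[OF e(5)]
    this(1)[OF e(6)] this(2)[OF e(1)] this(2)[OF e(6)]
  have ne: "a \<noteq> b" "b \<noteq> d" "a \<noteq> d" "a \<noteq> v" "b \<noteq> v" "d \<noteq> v" and "{a, b, d, v} \<subseteq> verts G"
    by auto
  then have "clique G {a, b, d, v}" using e by (auto simp: clique_def insert_commute)
  moreover have "finite {S. clique G S}"
    by (rule finite_subset[of _ "Pow (verts G)"])
      (use assms(1) in \<open>auto simp: clique_def simple_graph_def\<close>)
  ultimately have "card {a, b, d, v} \<le> clique_number G"
    unfolding clique_number_def by (intro Max_ge) auto
  then show False using ne assms(2) by simp
qed

text \<open>Assuming only degree at most 8 serves both claims at once: smaller degrees are excluded,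
  and degree 8 is identified.\<close>

lemma minimal_neighborhood_isomorphic:
  fixes G :: "'a graph"
  assumes "simple_graph G" "minimal_ramsey33 G" "clique_number G = 3" "v \<in> verts G" "degree G v \<le> 8"
  shows "degree G v = 8 \<and> (\<exists>i\<in>{1..7}. isomorphic (neighborhood_graph G v) (N8 i))"
proof -
  let ?N = "neighborhood_graph G v"
  have verts: "verts ?N = neighbors G v"
    by (simp add: neighborhood_graph_def induced_subgraph_def)
  have simple: "simple_graph ?N"
    using assms(1) by (auto simp: simple_graph_def neighborhood_graph_def induced_subgraph_def neighbors_def)
  have card: "card (verts ?N) \<le> 8" using assms(5) by (simp add: verts degree_def)
  obtain c :: "'a set \<Rightarrow> bool"
    where c: "\<forall>x. \<exists>a b. {a, b} \<in> edges ?N \<and> x a = c {a, b} \<and> x b = c {a, b}"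
    using minimal_neighborhood_unextendable[OF assms(1,2,4)] by blast
  from unextendable_isomorphic[OF simple neighborhood_triangle_free[OF assms(1,3,4)] card spec[OF c]]
  obtain h where h: "h \<in> set catalogue" "isomorphic ?N (graph_of h)" by blast
  have "degree G v = 8"
    using isomorphic_card[OF h(2)] by (simp add: verts degree_def graph_of_def)
  \<comment> \<open>The list chosen for \<open>N8\<close> need not be the catalogue, but it contains
    a copy of every graph satisfying \<open>marked8\<close>, hence of
    \<open>graph_of h\<close>.\<close>
  moreover obtain i where "i \<in> {1..7}" "isomorphic (graph_of h) (N8 i)"
    using lists_marked8_N8 marked8_catalogue[OF h(1)] unfolding lists_marked8_def by blast
  ultimately show ?thesis using isomorphic_trans[OF h(2)] by blast
qed

theorem theorem8p2:
  fixes G :: "'a graph"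
  assumes "simple_graph G"
    and "minimal_ramsey33 G"
    and "clique_number G = 3"
  shows "min_degree G \<ge> 8 \<and>
    (\<forall>v\<in>verts G. degree G v = 8 \<longrightarrow>
       (\<exists>i\<in>{1..7}. isomorphic (neighborhood_graph G v) (N8 i)))"
proof
  \<comment> \<open>The minimum in \<open>min_degree\<close> is meaningful only for a nonempty
    vertex set; a graph without vertices has no edges and is not Ramsey.\<close>
  have "verts G \<noteq> {}"
  proof
    assume "verts G = {}"
    with assms(1) have "edges G = {}" by (auto simp: simple_graph_def)
    then have "free33_coloring G (\<lambda>_. True)" by (simp add: free33_coloring_def triangle_def)
    then show False using assms(2) by (simp add: minimal_ramsey33_def ramsey33_def)
  qed
  moreover have "degree G v \<ge> 8" if "v \<in> verts G" for v
    using minimal_neighborhood_isomorphic[OF assms that] by linarith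
  moreover have "finite (verts G)" using assms(1) by (simp add: simple_graph_def)
  ultimately show "min_degree G \<ge> 8" unfolding min_degree_def by simp
  show "\<forall>v\<in>verts G. degree G v = 8 \<longrightarrow>
      (\<exists>i\<in>{1..7}. isomorphic (neighborhood_graph G v) (N8 i))"
    using minimal_neighborhood_isomorphic[OF assms] by simp
qed

end
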